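(* Let $\mathbf{c},\mathbf{v}_0\in\mathbb{R}^d$ with $\mathbf{c}>0$ and $\mathbf{v}_0>0$ (componentwise), and let $f(\mathbf{x}):=e^{\mathbf{c}^{\top}\mathbf{x}}-1$. For $u>0$ let $Q_u:=\mathbf{v}_0+u[0,1]^d$ and $F:=\max_{\mathbf{x}\in Q_u}f(\mathbf{x})=f(\mathbf{v}_0+u\mathbf{1})=e^{\mathbf{c}^{\top}\mathbf{v}_0}e^{u\mathbf{c}^{\top}\mathbf{1}}-1$. Then $$\lim_{u\to\infty}\frac{\operatorname{vol}(P^0(f,Q_u,F))}{\operatorname{vol}(P^0(f,Q_u,\operatorname{conc}(f)))}=d+1.$$
   Context: $\mathbf{1}$ is the all-ones vector. $\operatorname{conc}(f)$ denotes the concave envelope of $f$ over $Q_u$, i.e., the smallest concave function on $Q_u$ that is $\ge f$ on $Q_u$. For a concave upper bound $\mu$ of $f$ on a polytope $Q\subset\mathbb{R}^d_{\ge0}\setminus\{\mathbf{0}\}$ (a concave function $\mu:Q\to\mathbb{R}$ with $\mu\ge f$ on $Q$), put $\tilde\mu(\mathbf{x},z):=z\mu(\mathbf{x}/z)$ for $z>0$, $\mathbf{x}\in z\cdot Q$, and (closure convention) $\tilde\mu(\mathbf{0},0):=0$; the naïve relaxation is $$P^0(f,Q,\mu):=\{(\mathbf{x},y,z)\in\mathbb{R}^d\times\mathbb{R}\times\mathbb{R}:\ \tilde\mu(\mathbf{x},z)\ge y\ge f(\mathbf{x}),\ \mathbf{x}\in z\cdot Q,\ 1\ge z\ge 0\}.$$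 In $P^0(f,Q_u,F)$ the upper bound is the constant function $F$. $\operatorname{vol}$ denotes Lebesgue measure in $\mathbb{R}^{d+2}$. *)

theory Defs
  imports "HOL-Analysis.Analysis"
begin

text \<open>
  The concave envelope of \<open>f\<close> over \<open>Q\<close>, as the pointwise infimum of all concave majorants.
  The lemma \<open>concave_envelope_is_least\<close> below confirms that this is the smallest concave majorant
  whenever \<open>Q\<close> is convex and there is a concave majorant at all. Only the values on \<open>Q\<close> are
  meaningful.
\<close>
definition concave_envelope :: "'a::real_vector set \<Rightarrow> ('a \<Rightarrow> real) \<Rightarrow> 'a \<Rightarrow> real" where
  "concave_envelope Q f x = Inf {g x | g. concave_on Q g \<and> (\<forall>y\<in>Q. f y \<le> g y)}"

text \<open>
  For \<open>z = 0\<close> only \<open>x = 0\<close> is relevant, where the closure convention prescribes the value \<open>0\<close>.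
\<close>
definition perspective :: "('a::real_vector \<Rightarrow> real) \<Rightarrow> 'a \<Rightarrow> real \<Rightarrow> real" where
  "perspective \<mu> x z = (if z > 0 then z * \<mu> (x /\<^sub>R z) else 0)"

definition naive_relaxation ::
    "('a::real_vector \<Rightarrow> real) \<Rightarrow> 'a set \<Rightarrow> ('a \<Rightarrow> real) \<Rightarrow> ('a \<times> real \<times> real) set" where
  "naive_relaxation f Q \<mu> =
     {(x, y, z). perspective \<mu> x z \<ge> y \<and> y \<ge> f x \<and> x \<in> (\<lambda>q. z *\<^sub>R q) ` Q \<and> 1 \<ge> z \<and> z \<ge> 0}"

definition exp_lin :: "real ^ 'n \<Rightarrow> real ^ 'n \<Rightarrow> real" where
  "exp_lin c x = exp (c \<bullet> x) - 1"

text \<open>Here \<open>1\<close> is the all-ones vector, so \<open>cbox 0 1\<close> is the unit cube.\<close>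
definition shifted_cube :: "real ^ 'n \<Rightarrow> real \<Rightarrow> (real ^ 'n) set" where
  "shifted_cube v u = (\<lambda>t. v + u *\<^sub>R t) ` cbox 0 1"

text \<open>The supremum is attained for positive \<open>c\<close> and \<open>u\<close>; see \<open>max_value_attained\<close> below.\<close>
definition max_value :: "real ^ 'n \<Rightarrow> real ^ 'n \<Rightarrow> real \<Rightarrow> real" where
  "max_value c v u = (SUP x\<in>shifted_cube v u. exp_lin c x)"

lemma concave_envelope_is_least:
  fixes f :: "'a::real_vector \<Rightarrow> real"
  assumes "convex Q" and ex: "concave_on Q g0" "\<And>x. x \<in> Q \<Longrightarrow> f x \<le> g0 x"
  shows "concave_on Q (concave_envelope Q f)"
    and "\<And>x. x \<in> Q \<Longrightarrow> f x \<le> concave_envelope Q f x"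
    and "\<And>h x. concave_on Q h \<Longrightarrow> (\<And>y. y \<in> Q \<Longrightarrow> f y \<le> h y) \<Longrightarrow> x \<in> Q \<Longrightarrow>
           concave_envelope Q f x \<le> h x"
proof -
  let ?S = "\<lambda>x. {g x | g. concave_on Q g \<and> (\<forall>y\<in>Q. f y \<le> g y)}"
  have ne: "?S x \<noteq> {}" for x using ex by blast
  have bdd: "bdd_below (?S x)" if "x \<in> Q" for x
    using that by (intro bdd_belowI[of _ "f x"]) auto
  show ge: "f x \<le> concave_envelope Q f x" if "x \<in> Q" for x
    unfolding concave_envelope_def using that by (intro cInf_greatest ne) auto
  show le: "concave_envelope Q f x \<le> h x"
    if "concave_on Q h" "\<And>y. y \<in> Q \<Longrightarrow> f y \<le> h y" "x \<in> Q" for h x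
    unfolding concave_envelope_def using that by (intro cInf_lower bdd) auto
  show "concave_on Q (concave_envelope Q f)"
    unfolding concave_on_iff
  proof (intro conjI ballI allI impI)
    show "convex Q" by fact
    fix x y and a b :: real
    assume xy: "x \<in> Q" "y \<in> Q" and ab: "0 \<le> a" "0 \<le> b" "a + b = 1"
    show "a * concave_envelope Q f x + b * concave_envelope Q f y
            \<le> concave_envelope Q f (a *\<^sub>R x + b *\<^sub>R y)"
      unfolding concave_envelope_def[of Q f "a *\<^sub>R x + b *\<^sub>R y"]
    proof (rule cInf_greatest[OF ne])
      fix r assume "r \<in> ?S (a *\<^sub>R x + b *\<^sub>R y)"
      then obtain g where g: "r = g (a *\<^sub>R x + b *\<^sub>R y)" "concave_on Q g" "\<forall>y\<in>Q. f y \<le> g y"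
        by blast
      have "a * concave_envelope Q f x + b * concave_envelope Q f y \<le> a * g x + b * g y"
        using g xy ab by (intro add_mono mult_left_mono le) auto
      also have "\<dots> \<le> r"
        using g(2) xy ab unfolding g(1) concave_on_iff by blast
      finally show "a * concave_envelope Q f x + b * concave_envelope Q f y \<le> r" .
    qed
  qed
qed

lemma max_value_attained:
  fixes c v :: "real ^ 'n"
  assumes c: "\<And>i. c $ i > 0" and u: "u > 0"
  shows "v + u *\<^sub>R 1 \<in> shifted_cube v u"
    and "\<And>x. x \<in> shifted_cube v u \<Longrightarrow> exp_lin c x \<le> exp_lin c (v + u *\<^sub>R 1)"
    and "max_value c v u = exp_lin c (v + u *\<^sub>R 1)"
    and "max_value c v u = exp (c \<bullet> v) * exp (u * (c \<bullet> 1)) - 1"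
proof -
  show mem: "v + u *\<^sub>R 1 \<in> shifted_cube v u"
    unfolding shifted_cube_def by (intro imageI) (auto simp: mem_box_cart)
  show le: "exp_lin c x \<le> exp_lin c (v + u *\<^sub>R 1)" if x: "x \<in> shifted_cube v u" for x
  proof -
    obtain t where t: "x = v + u *\<^sub>R t" "t \<in> cbox 0 1"
      using x unfolding shifted_cube_def by (rule imageE)
    have "c \<bullet> t \<le> c \<bullet> 1"
      unfolding inner_vec_def using c t(2)
      by (intro sum_mono) (simp add: less_imp_le mem_box_cart)
    then show ?thesis using u by (simp add: exp_lin_def t(1) inner_add_right)
  qed
  show eq: "max_value c v u = exp_lin c (v + u *\<^sub>R 1)"
    unfolding max_value_def by (rule cSup_eq_maximum) (use mem le in auto)
  show "max_value c v u = exp (c \<bullet> v) * exp (u * (c \<bullet> 1)) - 1"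
    unfolding eq by (simp add: exp_lin_def inner_add_right exp_add)
qed

end

theory Submission imports Defs begin

text \<open>
  For a bound \<open>\<mu>\<close> the relaxation is, up to a small defect, a cone. Dividing by \<open>z\<close> turns the condition
  \<open>y \<le> z * \<mu> (x / z)\<close> into membership of \<open>(x / z, y / z)\<close> in the hypograph of \<open>\<mu>\<close> over \<open>Q\<close>, so the upper
  bound alone (with \<open>y \<ge> 0\<close>) describes the cone with apex \<open>0\<close> over that hypograph, placed at height \<open>z = 1\<close>.
  By \<open>measure_cone_over\<close> its volume is the volume of the hypograph divided by \<open>d + 2\<close>. What the lower bound
  \<open>y \<ge> f x\<close> removes from this cone lies, since \<open>f\<close> is convex with \<open>f 0 = 0\<close>, in the cone over the
  hypograph of \<open>f\<close> itself (\<open>measure_naive_relaxation_bounds\<close>).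

  Let \<open>Q\<close> be the cube of side \<open>u\<close> and \<open>F\<close> the maximum of \<open>f\<close>, and measure everything relative to the
  prism of volume \<open>F * u ^ d\<close> over \<open>Q\<close>. For \<open>\<mu> = F\<close> the hypograph is the whole prism. The hypograph of \<open>f\<close>
  has a vanishing share, because \<open>f\<close> decays exponentially away from each facet through the top corner
  (\<open>hypograph_exp_lin_subset\<close>). For the concave envelope, let \<open>t\<close> in the unit cube be the
  rescaled position in \<open>Q\<close>. Concavity, with the value \<open>F\<close> at the top corner and values \<open>\<ge> 0\<close> elsewhere,
  bounds the envelope below by \<open>F * (MIN i. t $ i)\<close>. Conversely, in each coordinate direction convexity of
  \<open>f\<close> gives an affine majorant \<open>F * t $ i\<close> plus a term that is exponentially small relative to \<open>F\<close>. So the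
  hypograph of the envelope is asymptotically the pyramid below \<open>F * (MIN i. t $ i)\<close>, whose slice at
  height \<open>s\<close> is a cube of side \<open>u * (1 - s / F)\<close> and whose share of the prism is therefore \<open>1 / (d + 1)\<close>
  (\<open>content_pyramid\<close>). The ratio of the two shares tends to \<open>d + 1\<close>.
\<close>

section \<open>Volumes of cones\<close>

text \<open>
  The part of the hypograph of \<open>\<mu>\<close> over \<open>Q\<close> that lies above the zero level.
\<close>
definition hypograph :: "'a set \<Rightarrow> ('a \<Rightarrow> real) \<Rightarrow> ('a \<times> real) set" where
  "hypograph Q \<mu> = {(q, s). q \<in> Q \<and> 0 \<le> s \<and> s \<le> \<mu> q}"

text \<open>
  The cone with apex \<open>0\<close> over the copy of \<open>E\<close> at height \<open>z = 1\<close>, with the height as last coordinate.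
  The apex itself is left out, which keeps the division by \<open>z\<close> meaningful.
\<close>
definition cone_over :: "('a::real_vector \<times> real) set \<Rightarrow> ('a \<times> real \<times> real) set" where
  "cone_over E = {(x, y, z). 0 < z \<and> z \<le> 1 \<and> (x /\<^sub>R z, y / z) \<in> E}"

lemma emeasure_scaled_set:
  fixes E :: "'a::euclidean_space set"
  assumes z: "z > 0" and E: "E \<in> sets borel"
  shows "emeasure lborel {p. p /\<^sub>R z \<in> E} = ennreal (z ^ DIM('a)) * emeasure lborel E"
proof -
  have "(\<lambda>p. p /\<^sub>R z) -` E \<inter> space borel \<in> sets borel"
    using E by (intro measurable_sets) auto
  then have A: "{p. p /\<^sub>R z \<in> E} \<in> sets borel"
    by (simp add: vimage_def)
  have "emeasure lborel {p. p /\<^sub>R z \<in> E} =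
      emeasure (density (distr lborel borel (\<lambda>x. 0 + z *\<^sub>R x)) (\<lambda>_. ennreal (\<bar>z\<bar> ^ DIM('a)))) {p. p /\<^sub>R z \<in> E}"
    using z lborel_affine[of z "0::'a"] by simp
  also have "\<dots> = ennreal (z ^ DIM('a)) * emeasure lborel E"
    using z A by (simp add: emeasure_density nn_integral_cmult emeasure_distr vimage_def)
  finally show ?thesis .
qed

lemma nn_integral_power_Icc01:
  "(\<integral>\<^sup>+z. ennreal (z ^ n) * indicator {0..1} z \<partial>lborel) = ennreal (1 / (real n + 1))"
proof -
  have "(\<integral>\<^sup>+z. ennreal (z ^ n) * indicator {0..1} z \<partial>lborel)
      = ennreal (1 ^ Suc n / real (Suc n) - 0 ^ Suc n / real (Suc n))"
    by (rule nn_integral_FTC_Icc)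
      (auto intro!: derivative_eq_intros simp del: power_Suc of_nat_Suc)
  then show ?thesis by (simp add: add.commute)
qed

lemma cone_over_borel:
  fixes E :: "('a::euclidean_space \<times> real) set"
  assumes "E \<in> sets borel"
  shows "cone_over E \<in> sets borel"
proof -
  have [measurable]: "E \<in> sets (borel \<Otimes>\<^sub>M borel)"
    using assms unfolding borel_prod .
  have "{p \<in> space (borel \<Otimes>\<^sub>M borel \<Otimes>\<^sub>M borel). 0 < snd (snd p) \<and> snd (snd p) \<le> 1 \<and>
      (fst p /\<^sub>R snd (snd p), fst (snd p) / snd (snd p)) \<in> E} \<in> sets (borel \<Otimes>\<^sub>M borel \<Otimes>\<^sub>M borel)"
    by measurable
  then show ?thesis
    unfolding borel_prod by (simp add: cone_over_def case_prod_beta')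
qed

text \<open>
  Slicing along the last of three coordinates; the reassociation of the product comes from Fubini's
  theorem.
\<close>
lemma emeasure_lborel_triple:
  fixes A :: "('a::euclidean_space \<times> real \<times> real) set"
  assumes "A \<in> sets borel"
  shows "emeasure lborel A = (\<integral>\<^sup>+z. emeasure lborel {(x, y). (x, y, z) \<in> A} \<partial>lborel)"
proof -
  have [measurable]: "A \<in> sets (borel \<Otimes>\<^sub>M borel \<Otimes>\<^sub>M borel)"
    using assms unfolding borel_prod .
  have slice: "{(x, y). (x, y, z) \<in> A} \<in> sets (borel \<Otimes>\<^sub>M borel)" for z
  proof -
    have "{p \<in> space (borel \<Otimes>\<^sub>M borel). (fst p, snd p, z) \<in> A} \<in> sets (borel \<Otimes>\<^sub>M borel)"
      by measurable
    then show ?thesis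
      by (simp add: case_prod_beta' space_pair_measure)
  qed
  have "emeasure lborel A = (\<integral>\<^sup>+p. indicator A p \<partial>(lborel \<Otimes>\<^sub>M lborel))"
    using assms unfolding lborel_prod by simp
  also have "\<dots> = (\<integral>\<^sup>+x. \<integral>\<^sup>+q. indicator A (x, q) \<partial>(lborel \<Otimes>\<^sub>M lborel) \<partial>lborel)"
    unfolding lborel_prod[where ?'a = real and ?'b = real]
    by (rule lborel.nn_integral_fst[symmetric]) (use assms in \<open>simp add: lborel_prod\<close>)
  also have "\<dots> = (\<integral>\<^sup>+x. \<integral>\<^sup>+z. \<integral>\<^sup>+y. indicator A (x, y, z) \<partial>lborel \<partial>lborel \<partial>lborel)"
    by (intro nn_integral_cong lborel_pair.nn_integral_snd[symmetric]) measurable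
  also have "\<dots> = (\<integral>\<^sup>+z. \<integral>\<^sup>+x. \<integral>\<^sup>+y. indicator A (x, y, z) \<partial>lborel \<partial>lborel \<partial>lborel)"
    by (rule lborel_pair.Fubini'[symmetric]) measurable
  also have "\<dots> = (\<integral>\<^sup>+z. \<integral>\<^sup>+q. indicator {(x, y). (x, y, z) \<in> A} q \<partial>(lborel \<Otimes>\<^sub>M lborel) \<partial>lborel)"
  proof (rule nn_integral_cong)
    fix z :: real
    have "(\<integral>\<^sup>+x. \<integral>\<^sup>+y. indicator {(x, y). (x, y, z) \<in> A} (x, y) \<partial>lborel \<partial>lborel)
        = (\<integral>\<^sup>+q. indicator {(x, y). (x, y, z) \<in> A} q \<partial>(lborel \<Otimes>\<^sub>M lborel))"
      by (rule lborel.nn_integral_fst) (use slice in simp)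
    then show "(\<integral>\<^sup>+x. \<integral>\<^sup>+y. indicator A (x, y, z) \<partial>lborel \<partial>lborel) = 
      (\<integral>\<^sup>+q. indicator {(x, y). (x, y, z) \<in> A} q \<partial>(lborel \<Otimes>\<^sub>M lborel))"
      by (simp add: indicator_def)
  qed
  also have "\<dots> = (\<integral>\<^sup>+z. emeasure lborel {(x, y). (x, y, z) \<in> A} \<partial>lborel)"
    using slice unfolding lborel_prod borel_prod by simp
  finally show ?thesis .
qed

text \<open>
  The slice of the cone at height \<open>z\<close> is \<open>E\<close> scaled by \<open>z\<close>, of measure \<open>z\<close> to the power
  \<open>DIM('a) + 1\<close> times that of \<open>E\<close>; integrating over \<open>z\<close> gives the factor.
\<close>
lemma emeasure_cone_over:
  fixes E :: "('a::euclidean_space \<times> real) set"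
  assumes E: "E \<in> sets borel"
  shows "emeasure lborel (cone_over E) = ennreal (1 / (real DIM('a) + 2)) * emeasure lborel E"
proof -
  have "emeasure lborel (cone_over E)
      = (\<integral>\<^sup>+z. emeasure lborel {(x, y). (x, y, z) \<in> cone_over E} \<partial>lborel)"
    by (intro emeasure_lborel_triple cone_over_borel E)
  also have "\<dots> = (\<integral>\<^sup>+z. ennreal (z ^ (DIM('a) + 1)) * indicator {0..1} z * emeasure lborel E \<partial>lborel)"
  proof (rule nn_integral_cong)
    fix z :: real
    show "emeasure lborel {(x, y). (x, y, z) \<in> cone_over E}
        = ennreal (z ^ (DIM('a) + 1)) * indicator {0..1} z * emeasure lborel E"
    proof (cases "0 < z \<and> z \<le> 1")
      case True
      then have "{(x, y). (x, y, z) \<in> cone_over E} = {p. p /\<^sub>R z \<in> E}"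
        by (auto simp: cone_over_def divide_inverse mult.commute)
      with True show ?thesis
        by (simp add: emeasure_scaled_set[OF _ E])
    next
      case False
      then have "{(x, y). (x, y, z) \<in> cone_over E} = {}"
        by (auto simp: cone_over_def)
      with False show ?thesis
        by (cases "z = 0") (auto simp: indicator_def)
    qed
  qed
  also have "\<dots> = (\<integral>\<^sup>+z. ennreal (z ^ (DIM('a) + 1)) * indicator {0..1} z \<partial>lborel) * emeasure lborel E"
    by (rule nn_integral_multc) simp
  also have "\<dots> = ennreal (1 / (real DIM('a) + 2)) * emeasure lborel E"
    by (simp only: nn_integral_power_Icc01) (simp add: algebra_simps)
  finally show ?thesis .
qed

lemma measure_cone_over:
  fixes E :: "('a::euclidean_space \<times> real) set"
  assumes "E \<in> sets borel" "bounded E"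
  shows "cone_over E \<in> lmeasurable"
    and "measure lebesgue (cone_over E) = measure lborel E / (real DIM('a) + 2)"
proof -
  have eq: "emeasure lborel (cone_over E) = ennreal (1 / (real DIM('a) + 2)) * emeasure lborel E"
    by (rule emeasure_cone_over[OF assms(1)])
  have "emeasure lborel E < \<infinity>"
    using assms(2) emeasure_bounded_finite by blast
  then have "emeasure lborel (cone_over E) < \<infinity>"
    by (simp add: eq ennreal_mult_less_top)
  then show "cone_over E \<in> lmeasurable"
    using cone_over_borel[OF assms(1)] by (auto intro: fmeasurableI)
  show "measure lebesgue (cone_over E) = measure lborel E / (real DIM('a) + 2)"
    using cone_over_borel[OF assms(1)] by (simp add: measure_def eq enn2real_mult)
qed

text \<open>
  The hypograph of a concave function need not be a Borel set. Measurability is instead read off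
  from convexity: with its apex restored, the cone over a bounded convex set is the convex hull of
  the apex and the base, and bounded convex sets are Lebesgue measurable.
\<close>
lemma insert_zero_cone_over_measurable:
  fixes H :: "('a::euclidean_space \<times> real) set"
  assumes "convex H" "bounded H"
  shows "insert 0 (cone_over H) \<in> lmeasurable"
proof (cases "H = {}")
  case True
  then have "insert 0 (cone_over H) = cbox 0 0"
    by (auto simp: cone_over_def)
  then show ?thesis by (metis lmeasurable_cbox)
next
  case False
  let ?K = "(\<lambda>(q, s). (q, s, 1::real)) ` H"
  have K: "?K = (\<lambda>p. (0, 0, 1) + p) ` (\<lambda>(q, s). (q, s, 0)) ` H"
    by (force simp: image_image)
  have lin: "linear (\<lambda>(q::'a, s::real). (q, s, 0::real))"
    by (intro linearI) auto
  have conv: "convex ?K"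
    unfolding K by (intro convex_translation convex_linear_image lin assms)
  have bdd: "bounded ?K"
    unfolding K by (intro bounded_translation bounded_linear_image lin assms)
      (simp add: lin linear_conv_bounded_linear[symmetric])
  have "insert 0 (cone_over H) = convex hull (insert 0 ?K)"
    (is "?L = ?R")
  proof (intro equalityI subsetI)
    fix p assume "p \<in> ?L"
    then consider "p = 0" | x y z where "p = (x, y, z)" "0 < z" "z \<le> 1" "(x /\<^sub>R z, y / z) \<in> H"
      by (auto simp: cone_over_def)
    then show "p \<in> ?R"
    proof cases
      case 1
      then show ?thesis by (simp add: hull_inc)
    next
      case 2
      then have "(x /\<^sub>R z, y / z, 1) \<in> ?K" by force
      then have "(1 - z) *\<^sub>R 0 + z *\<^sub>R (x /\<^sub>R z, y / z, 1) \<in> ?R"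
        using 2 by (intro convexD[OF convex_convex_hull]) (auto intro: hull_inc)
      with 2 show ?thesis by simp
    qed
  next
    fix p assume "p \<in> ?R"
    have hull: "convex hull ?K = ?K"
      using conv by (simp add: convex_hull_eq)
    have "?K \<noteq> {}"
      using False by simp
    from convex_hull_insert[OF this, of 0, unfolded hull]
    have "?R = {x. \<exists>u\<ge>0. \<exists>v\<ge>0. \<exists>b. u + v = 1 \<and> b \<in> ?K \<and> x = u *\<^sub>R 0 + v *\<^sub>R b}" .
    with \<open>p \<in> ?R\<close> have "p \<in> {x. \<exists>u\<ge>0. \<exists>v\<ge>0. \<exists>b. u + v = 1 \<and> b \<in> ?K \<and> x = u *\<^sub>R 0 + v *\<^sub>R b}"
      by blast
    then obtain u v b where "u \<ge> 0" "v \<ge> 0" "u + v = 1" "b \<in> ?K" "p = u *\<^sub>R 0 + v *\<^sub>R b"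
      by blast
    then have "v \<ge> 0" "v \<le> 1" "b \<in> ?K" "p = v *\<^sub>R b"
      by auto
    then show "p \<in> ?L"
      by (cases "v = 0") (auto simp: cone_over_def zero_prod_def)
  qed
  moreover have "bounded (convex hull (insert 0 ?K))"
    using bdd by (intro bounded_convex_hull) simp
  ultimately show ?thesis
    using measurable_convex[OF convex_convex_hull] by metis
qed

section \<open>Relaxations as truncated cones\<close>

text \<open>
  Nonnegativity of \<open>f\<close> on the cone forces \<open>y \<ge> 0\<close> in the relaxation, and \<open>f 0 = 0\<close> reduces the fibre
  over \<open>z = 0\<close> to the origin.
\<close>
lemma naive_relaxation_eq_cone_over:
  assumes Q: "Q \<noteq> {}" and f0: "f 0 = 0"
    and nonneg: "\<And>q z. q \<in> Q \<Longrightarrow> 0 \<le> z \<Longrightarrow> z \<le> 1 \<Longrightarrow> 0 \<le> f (z *\<^sub>R q)"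
  shows "naive_relaxation f Q \<mu> = insert 0 (cone_over (hypograph Q \<mu>)) \<inter> {(x, y, z). f x \<le> y}"
proof -
  have "(x, y, z) \<in> naive_relaxation f Q \<mu> \<longleftrightarrow>
      (x, y, z) \<in> insert 0 (cone_over (hypograph Q \<mu>)) \<and> f x \<le> y" for x y z
  proof -
    consider "z < 0 \<or> z > 1" | "z = 0" | "0 < z" "z \<le> 1" by linarith
    then show ?thesis
    proof cases
      case 1
      then show ?thesis
        by (auto simp: naive_relaxation_def cone_over_def zero_prod_def)
    next
      case 2
      then show ?thesis
        using Q f0 by (auto simp: naive_relaxation_def perspective_def cone_over_def zero_prod_def image_def)
    next
      case 3
      have img: "x \<in> (\<lambda>q. z *\<^sub>R q) ` Q \<longleftrightarrow> x /\<^sub>R z \<in> Q"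
        using 3 by (auto simp: image_iff intro: bexI[of _ "x /\<^sub>R z"])
      have "0 \<le> f x" if "x /\<^sub>R z \<in> Q"
        using nonneg[OF that, of z] 3 by simp
      then show ?thesis
        using 3 unfolding naive_relaxation_def img
        by (auto simp: perspective_def cone_over_def hypograph_def zero_prod_def img
            divide_le_eq mult.commute intro: order_trans)
    qed
  qed
  then show ?thesis by auto
qed

lemma cone_over_mono: "E \<subseteq> E' \<Longrightarrow> cone_over E \<subseteq> cone_over E'"
  by (auto simp: cone_over_def)

text \<open>
  The relaxation is squeezed between cones: it lies in the cone over the hypograph of \<open>\<mu>\<close> and misses
  of it at most the cone over the hypograph of \<open>f\<close>. The sets \<open>E\<^sub>1\<close>, \<open>E\<^sub>2\<close>, \<open>E\<^sub>3\<close> are Borel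
  approximations whose measure can be computed even when \<open>\<mu>\<close> has no closed form.
\<close>
lemma measure_naive_relaxation_bounds:
  fixes f \<mu> :: "'a::euclidean_space \<Rightarrow> real"
  assumes Q: "Q \<noteq> {}" and f: "convex_on UNIV f" "f 0 = 0"
    and nonneg: "\<And>q z. q \<in> Q \<Longrightarrow> 0 \<le> z \<Longrightarrow> z \<le> 1 \<Longrightarrow> 0 \<le> f (z *\<^sub>R q)"
    and conv: "convex (hypograph Q \<mu>)"
    and E1: "E\<^sub>1 \<in> sets borel" "E\<^sub>1 \<subseteq> hypograph Q \<mu>"
    and E2: "E\<^sub>2 \<in> sets borel" "bounded E\<^sub>2" "hypograph Q \<mu> \<subseteq> E\<^sub>2"
    and E3: "E\<^sub>3 \<in> sets borel" "bounded E\<^sub>3" "hypograph Q f \<subseteq> E\<^sub>3"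
  shows "measure lborel E\<^sub>1 - measure lborel E\<^sub>3
           \<le> (real DIM('a) + 2) * measure lebesgue (naive_relaxation f Q \<mu>)"
    and "(real DIM('a) + 2) * measure lebesgue (naive_relaxation f Q \<mu>) \<le> measure lborel E\<^sub>2"
proof -
  let ?P = "naive_relaxation f Q \<mu>" and ?H = "hypograph Q \<mu>"
  have bounded: "bounded ?H" "bounded E\<^sub>1"
    using bounded_subset[OF E2(2)] E1(2) E2(3) by auto
  have P_eq: "?P = insert 0 (cone_over ?H) \<inter> {(x, y, z). f x \<le> y}"
    by (rule naive_relaxation_eq_cone_over) (use Q f(2) nonneg in auto)
  have "continuous_on UNIV f"
    using f(1) by (intro convex_on_continuous) auto
  then have "continuous_on UNIV (\<lambda>p::'a \<times> real \<times> real. f (fst p))"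
    by (rule continuous_on_compose2) (auto intro: continuous_on_fst continuous_on_id)
  then have "closed {p :: 'a \<times> real \<times> real. f (fst p) \<le> fst (snd p)}"
    by (rule closed_Collect_le) (intro continuous_intros)
  then have "closed {(x::'a, y, z::real). f x \<le> y}"
    by (simp add: case_prod_beta')
  then have P: "?P \<in> lmeasurable"
    unfolding P_eq by (intro fmeasurable_Int_fmeasurable insert_zero_cone_over_measurable conv bounded)
      (auto intro: borel_closed)
  have C2: "cone_over E\<^sub>2 \<in> lmeasurable" and C3: "cone_over E\<^sub>3 \<in> lmeasurable"
      and C1: "cone_over E\<^sub>1 \<in> lmeasurable"
    using measure_cone_over E1(1) E2 E3 bounded by blast+
  have "cone_over E\<^sub>1 \<subseteq> ?P \<union> cone_over E\<^sub>3"
  proof clarify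
    fix x y z assume *: "(x, y, z) \<in> cone_over E\<^sub>1" "(x, y, z) \<notin> cone_over E\<^sub>3"
    then have 1: "(x, y, z) \<in> cone_over ?H" and 2: "(x, y, z) \<notin> cone_over (hypograph Q f)"
      using cone_over_mono E1 E3 by blast+
    then have z: "0 < z" "z \<le> 1" and xz: "x /\<^sub>R z \<in> Q" and y: "0 \<le> y"
      by (auto simp: cone_over_def hypograph_def zero_le_divide_iff)
    \<comment> \<open>Convexity together with \<open>f 0 = 0\<close> puts the region below \<open>f\<close> inside the cone
      over the hypograph of \<open>f\<close>.\<close>
    have "f ((1 - z) *\<^sub>R 0 + z *\<^sub>R (x /\<^sub>R z)) \<le> (1 - z) * f 0 + z * f (x /\<^sub>R z)"
      using z by (intro convex_onD[OF f(1)]) auto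
    then have "f x \<le> z * f (x /\<^sub>R z)"
      using z f(2) by simp
    moreover have "f (x /\<^sub>R z) < y / z"
      using 2 z xz y by (auto simp: cone_over_def hypograph_def)
    then have "z * f (x /\<^sub>R z) < y"
      using z by (simp add: less_divide_eq mult.commute)
    ultimately have "f x \<le> y" by simp
    with 1 show "(x, y, z) \<in> ?P"
      by (simp add: P_eq)
  qed
  then have "measure lebesgue (cone_over E\<^sub>1) \<le> measure lebesgue (?P \<union> cone_over E\<^sub>3)"
    using C1 C3 P by (intro measure_mono_fmeasurable) auto
  also have "\<dots> \<le> measure lebesgue ?P + measure lebesgue (cone_over E\<^sub>3)"
    using C3 P by (intro measure_Un_le) auto
  finally have "measure lborel E\<^sub>1 / (real DIM('a) + 2)
      \<le> measure lebesgue ?P + measure lborel E\<^sub>3 / (real DIM('a) + 2)"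
    using E1(1) E3 bounded by (simp add: measure_cone_over)
  then have "(measure lborel E\<^sub>1 - measure lborel E\<^sub>3) / (real DIM('a) + 2) \<le> measure lebesgue ?P"
    by (simp add: diff_divide_distrib)
  then show "measure lborel E\<^sub>1 - measure lborel E\<^sub>3 \<le> (real DIM('a) + 2) * measure lebesgue ?P"
    by (subst (asm) pos_divide_le_eq) (simp_all add: mult.commute)
  have "?P \<subseteq> {0} \<union> cone_over E\<^sub>2"
    using cone_over_mono[OF E2(3)] by (auto simp: P_eq)
  moreover have "{0 :: 'a \<times> real \<times> real} \<in> lmeasurable"
    by (simp add: negligible_imp_measurable)
  ultimately have "measure lebesgue ?P \<le> measure lebesgue ({0} \<union> cone_over E\<^sub>2)"
    using C2 P by (intro measure_mono_fmeasurable fmeasurable.Un) auto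
  also have "\<dots> \<le> measure lebesgue {0 :: 'a \<times> real \<times> real} + measure lebesgue (cone_over E\<^sub>2)"
    using C2 by (intro measure_Un_le) auto
  also have "\<dots> = measure lborel E\<^sub>2 / (real DIM('a) + 2)"
    using E2 by (simp add: measure_cone_over)
  finally show "(real DIM('a) + 2) * measure lebesgue ?P \<le> measure lborel E\<^sub>2"
    by (simp add: field_simps)
qed

lemma convex_hypograph:
  assumes "concave_on Q \<mu>"
  shows "convex (hypograph Q \<mu>)"
proof (rule convexI)
  fix p q :: "'a \<times> real" and a b :: real
  assume *: "p \<in> hypograph Q \<mu>" "q \<in> hypograph Q \<mu>" "0 \<le> a" "0 \<le> b" "a + b = 1"
  obtain x s y t where pq: "p = (x, s)" "q = (y, t)" by fastforce
  have "a * s + b * t \<le> a * \<mu> x + b * \<mu> y"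
    using * by (intro add_mono mult_left_mono) (auto simp: pq hypograph_def)
  also have "\<dots> \<le> \<mu> (a *\<^sub>R x + b *\<^sub>R y)"
    using assms * unfolding concave_on_iff by (auto simp: pq hypograph_def)
  finally show "a *\<^sub>R p + b *\<^sub>R q \<in> hypograph Q \<mu>"
    using * concave_on_imp_convex[OF assms]
    by (auto simp: pq hypograph_def intro: convexD)
qed

section \<open>Cubes and pyramids\<close>

lemma shifted_cube_eq_cbox:
  fixes v :: "real ^ 'n"
  assumes "u > 0"
  shows "shifted_cube v u = cbox v (v + u *\<^sub>R 1)"
proof -
  have "(0 :: real ^ 'n) \<in> cbox 0 1"
    by (simp add: mem_box_cart)
  then have "cbox 0 (1 :: real ^ 'n) \<noteq> {}" by blast
  then show ?thesis
    using assms image_affinity_cbox[of u v 0 "1 :: real ^ 'n"]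
    by (simp add: shifted_cube_def add.commute)
qed

lemma content_shifted_box:
  fixes v :: "real ^ 'n"
  assumes "r \<le> u"
  shows "measure lborel (cbox (v + r *\<^sub>R 1) (v + u *\<^sub>R 1)) = (u - r) ^ CARD('n)"
proof -
  have "v + u *\<^sub>R 1 \<in> cbox (v + r *\<^sub>R 1) (v + u *\<^sub>R 1)"
    using assms by (simp add: mem_box_cart)
  then have "cbox (v + r *\<^sub>R 1) (v + u *\<^sub>R 1) \<noteq> {}" by blast
  then show ?thesis
    by (simp add: content_cbox_cart)
qed

lemma content_cube_interval:
  fixes v :: "real ^ 'n"
  assumes "u > 0" "M \<ge> 0"
  shows "measure lborel (cbox (v, 0) (v + u *\<^sub>R 1, M)) = u ^ CARD('n) * M"
  using assms content_shifted_box[of 0 u v] by (simp add: content_Pair)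

text \<open>
  The region over the cube between the zero level and \<open>F * (MIN i. (q $ i - v $ i) / u)\<close>. It is a
  pyramid with its vertex at height \<open>F\<close> above the top corner \<open>v + u *\<^sub>R 1\<close>.
\<close>
definition pyramid :: "real ^ 'n \<Rightarrow> real \<Rightarrow> real \<Rightarrow> ((real ^ 'n) \<times> real) set" where
  "pyramid v u F = {(q, s). q \<in> shifted_cube v u \<and> 0 \<le> s \<and> (\<forall>i. s \<le> F * ((q $ i - v $ i) / u))}"

lemma closed_pyramid:
  fixes v :: "real ^ 'n"
  assumes "u > 0"
  shows "closed (pyramid v u F)"
proof -
  have "pyramid v u F = (shifted_cube v u \<times> {0..}) \<inter> (\<Inter>i. {p. snd p \<le> F * ((fst p $ i - v $ i) / u)})"
    by (auto simp: pyramid_def)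
  moreover have "closed {p :: (real ^ 'n) \<times> real. snd p \<le> F * ((fst p $ i - v $ i) / u)}" for i
    using assms by (intro closed_Collect_le continuous_intros) auto
  moreover have "closed (shifted_cube v u \<times> {0 :: real..})"
    using assms by (intro closed_Times) (auto simp: shifted_cube_eq_cbox closed_cbox)
  ultimately show ?thesis
    by (simp add: closed_Int closed_INT)
qed

lemma pyramid_subset:
  fixes v :: "real ^ 'n"
  assumes "u > 0" "F > 0"
  shows "pyramid v u F \<subseteq> cbox (v, 0) (v + u *\<^sub>R 1, F)"
proof -
  have "(q, s) \<in> cbox (v, 0) (v + u *\<^sub>R 1, F)" if qs: "(q, s) \<in> pyramid v u F" for q s
  proof -
    have q: "q \<in> shifted_cube v u" and s: "0 \<le> s" "s \<le> F * ((q $ i - v $ i) / u)" for i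
      using qs by (auto simp: pyramid_def)
    \<comment> \<open>Any coordinate will do; index types are nonempty.\<close>
    obtain i :: 'n where True by simp
    have "q $ i - v $ i \<le> u"
      using q assms(1) by (simp add: shifted_cube_eq_cbox mem_box_cart algebra_simps)
    then have "F * ((q $ i - v $ i) / u) \<le> F * 1"
      using assms by (intro mult_left_mono) auto
    with s(2)[of i] have "s \<le> F" by simp
    with q s(1) assms(1) show "(q, s) \<in> cbox (v, 0) (v + u *\<^sub>R 1, F)"
      by (simp add: cbox_Pair_eq shifted_cube_eq_cbox)
  qed
  then show ?thesis by (auto simp del: cbox_Pair_iff)
qed

text \<open>
  The slice at height \<open>s\<close> is a cube of side \<open>u * (1 - s / F)\<close>.
\<close>
lemma content_pyramid:
  fixes v :: "real ^ 'n"
  assumes u: "u > 0" and F: "F > 0"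
  shows "measure lborel (pyramid v u F) = u ^ CARD('n) * F / (real CARD('n) + 1)"
proof -
  let ?d = "CARD('n)"
  have slice: "emeasure lborel ((\<lambda>q. (q, s)) -` pyramid v u F)
      = ennreal ((u - u * s / F) ^ ?d) * indicator {0..F} s" for s
  proof (cases "0 \<le> s \<and> s \<le> F")
    case True
    have "(\<lambda>q. (q, s)) -` pyramid v u F = cbox (v + (u * s / F) *\<^sub>R 1) (v + u *\<^sub>R 1)"
    proof -
      have le_iff: "s \<le> F * ((q $ i - v $ i) / u) \<longleftrightarrow> v $ i + u * s / F \<le> q $ i" for q i
        using u F by (simp add: field_simps)
      have low: "v $ i \<le> v $ i + u * s / F" for i
        using True u F by simp
      show ?thesis
        using True u by (auto simp: pyramid_def le_iff[unfolded times_divide_eq_right] shifted_cube_eq_cbox mem_box_cart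
            intro: order_trans[OF low])
    qed
    moreover have "u * s / F \<le> u"
      using True u F by (simp add: field_simps)
    moreover have "emeasure lborel (cbox p q) = ennreal (measure lborel (cbox p q))" for p q :: "real ^ 'n"
      using emeasure_lborel_cbox_finite[of p q] by (intro emeasure_eq_ennreal_measure) auto
    ultimately show ?thesis
      using True by (simp add: content_shifted_box del: emeasure_lborel_cbox)
  next
    case False
    then have "(\<lambda>q. (q, s)) -` pyramid v u F = {}"
      using pyramid_subset[OF u F, of v] by (fastforce simp: cbox_Pair_eq)
    with False show ?thesis by (simp add: indicator_def)
  qed
  have "emeasure lborel (pyramid v u F) = emeasure (lborel \<Otimes>\<^sub>M lborel) (pyramid v u F)"
    by (simp add: lborel_prod)
  also have "\<dots> = (\<integral>\<^sup>+s. emeasure lborel ((\<lambda>q. (q, s)) -` pyramid v u F) \<partial>lborel)"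
    by (rule lborel_pair.emeasure_pair_measure_alt2)
      (use closed_pyramid[OF u, of v F] in \<open>simp only: lborel_prod sets_lborel borel_closed\<close>)
  also have "\<dots> = (\<integral>\<^sup>+s. ennreal ((u - u * s / F) ^ ?d) * indicator {0..F} s \<partial>lborel)"
    by (simp add: slice)
  also have "\<dots> = ennreal (- (F / u) * (u - u * F / F) ^ Suc ?d / real (Suc ?d)
      - (- (F / u) * (u - u * 0 / F) ^ Suc ?d / real (Suc ?d)))"
  proof (rule nn_integral_FTC_Icc[where F = "\<lambda>s. - (F / u) * (u - u * s / F) ^ Suc ?d / real (Suc ?d)"])
    fix s assume "s \<in> {0..F}"
    then show "0 \<le> (u - u * s / F) ^ ?d"
      using u F by (intro zero_le_power) (simp add: field_simps)
    show "((\<lambda>s. - (F / u) * (u - u * s / F) ^ Suc ?d / real (Suc ?d))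
        has_real_derivative (u - u * s / F) ^ ?d) (at s)"
      using u F by (auto intro!: derivative_eq_intros simp del: power_Suc of_nat_Suc)
  qed (use F in auto)
  also have "\<dots> = ennreal (u ^ ?d * F / (real ?d + 1))"
    using u F by (simp add: field_simps)
  finally show ?thesis
    using u F by (simp add: measure_def)
qed

section \<open>The exponential on a cube and its concave envelope\<close>

lemma convex_exp_lin:
  "convex_on UNIV (exp_lin c)"
proof (rule convex_onI)
  fix t :: real and x y :: "real ^ 'a"
  assume "0 < t" "t < 1"
  then have "exp ((1 - t) * (c \<bullet> x) + t * (c \<bullet> y)) \<le> (1 - t) * exp (c \<bullet> x) + t * exp (c \<bullet> y)"
    using convex_onD[OF exp_convex, of t "c \<bullet> x" "c \<bullet> y"] by simp
  then show "exp_lin c ((1 - t) *\<^sub>R x + t *\<^sub>R y) \<le> (1 - t) * exp_lin c x + t * exp_lin c y"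
    by (simp add: exp_lin_def inner_add_right algebra_simps)
qed simp

lemma mem_shifted_cube:
  fixes v :: "real ^ 'n"
  assumes u: "u > 0"
  shows "q \<in> shifted_cube v u \<longleftrightarrow> (\<forall>i. v $ i \<le> q $ i \<and> q $ i \<le> v $ i + u)"
  using u by (simp add: shifted_cube_eq_cbox mem_box_cart)

lemma convex_shifted_cube:
  fixes v :: "real ^ 'n"
  assumes u: "u > 0"
  shows "convex (shifted_cube v u)"
  using u by (simp add: shifted_cube_eq_cbox)

lemma concave_const_shifted_cube:
  fixes v :: "real ^ 'n"
  assumes u: "u > 0"
  shows "concave_on (shifted_cube v u) (\<lambda>_. a)"
  using convex_shifted_cube[OF u] by (simp add: concave_on_iff flip: distrib_right)

text \<open>
  The prism of height \<open>F\<close> over the slab of the cube in which coordinate \<open>k\<close> is within \<open>\<delta> * u\<close> of its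
  maximum.
\<close>
lemma content_slab:
  fixes v :: "real ^ 'n"
  assumes u: "u > 0" and F: "F \<ge> 0" and \<delta>: "0 \<le> \<delta>" "\<delta> \<le> 1"
  shows "measure lborel (cbox (v + axis k ((1 - \<delta>) * u), 0) (v + u *\<^sub>R 1, F)) = \<delta> * u ^ CARD('n) * F"
proof -
  let ?a = "v + axis k ((1 - \<delta>) * u)" and ?b = "v + u *\<^sub>R (1 :: real ^ 'n)"
  have "(1 - \<delta>) * u \<le> 1 * u"
    using u \<delta> by (intro mult_right_mono) auto
  then have "?b \<in> cbox ?a ?b"
    using u by (auto simp: mem_box_cart axis_def)
  then have "cbox ?a ?b \<noteq> {}" by blast
  then have "measure lborel (cbox ?a ?b) = (\<Prod>i\<in>UNIV. u - axis k ((1 - \<delta>) * u) $ i)"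
    by (simp add: content_cbox_cart algebra_simps)
  also have "\<dots> = (\<Prod>i\<in>UNIV. u * (if i = k then \<delta> else 1))"
    by (intro prod.cong) (auto simp: axis_def algebra_simps)
  also have "\<dots> = \<delta> * u ^ CARD('n)"
    by (simp add: prod.distrib)
  finally show ?thesis
    using F by (simp add: content_Pair)
qed

text \<open>
  In this context \<open>F\<close> is the largest value of the function on the cube.
\<close>
context
  fixes c v :: "real ^ 'n" and u F :: real
  assumes c: "\<And>i. c $ i > 0" and v: "\<And>i. v $ i > 0" and u: "u > 0"
  defines "F \<equiv> exp_lin c (v + u *\<^sub>R 1)"
begin

lemma exp_lin_nonneg:
  assumes "q \<in> shifted_cube v u" "0 \<le> z"
  shows "0 \<le> exp_lin c (z *\<^sub>R q)"
proof -
  have "0 \<le> q $ i" for i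
    using assms v[of i] by (auto simp: mem_shifted_cube[OF u] intro: order_trans less_imp_le)
  then have "0 \<le> c \<bullet> q"
    unfolding inner_vec_def using c by (intro sum_nonneg) (simp add: less_imp_le)
  then show ?thesis
    using assms(2) by (simp add: exp_lin_def)
qed

lemma peak_pos: "F > 0"
proof -
  have "c \<bullet> (v + u *\<^sub>R 1) > 0"
    unfolding inner_vec_def using c v u by (intro sum_pos) (auto simp: add_pos_pos)
  then show ?thesis by (simp add: F_def exp_lin_def)
qed

text \<open>
  Away from the top corner the function decays exponentially in the distance from any single facet
  through that corner.
\<close>
lemma exp_lin_le_decay:
  assumes q: "q \<in> shifted_cube v u"
  shows "exp (c \<bullet> q) \<le> (F + 1) * exp (- (c $ i * (v $ i + u - q $ i)))"
proof -
  have nonneg: "0 \<le> c $ j * (v $ j + u - q $ j)" for j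
    using q c[of j] by (intro mult_nonneg_nonneg) (auto simp: mem_shifted_cube[OF u] less_imp_le)
  have "c $ i * (v $ i + u - q $ i) \<le> (\<Sum>j\<in>UNIV. c $ j * (v $ j + u - q $ j))"
    by (rule member_le_sum) (use nonneg in auto)
  also have "\<dots> = c \<bullet> (v + u *\<^sub>R 1 - q)"
    by (simp add: inner_vec_def)
  finally have "c \<bullet> q \<le> c \<bullet> (v + u *\<^sub>R 1) + (- (c $ i * (v $ i + u - q $ i)))"
    by (simp add: inner_diff_right)
  then show ?thesis
    by (simp add: F_def exp_lin_def flip: exp_add)
qed

text \<open>
  Along coordinate \<open>i\<close>, convexity of the exponential puts the decay bound below its chord. The result is
  an affine majorant, one for each \<open>i\<close>, which therefore also lies above the concave envelope.
\<close>
lemma exp_lin_le_affine: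
  assumes q: "q \<in> shifted_cube v u"
  shows "exp_lin c q \<le> F * ((q $ i - v $ i) / u) + (F + 1) * exp (- (c $ i * u))"
proof -
  define t where "t = (q $ i - v $ i) / u"
  have t: "0 \<le> t" "t \<le> 1"
    using q u by (auto simp: mem_shifted_cube[OF u] t_def divide_le_eq algebra_simps)
  have eq: "- (c $ i * (v $ i + u - q $ i)) = (1 - t) * (- (c $ i * u)) + t * 0"
    using u by (simp add: t_def field_simps)
  have "exp (- (c $ i * (v $ i + u - q $ i))) \<le> (1 - t) * exp (- (c $ i * u)) + t"
    using convex_onD[OF exp_convex, of t "- (c $ i * u)" 0] t unfolding eq by simp
  also have "\<dots> \<le> exp (- (c $ i * u)) + t"
    using t by (simp add: mult_left_le_one_le)
  finally have "(F + 1) * exp (- (c $ i * (v $ i + u - q $ i))) \<le> (F + 1) * (exp (- (c $ i * u)) + t)"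
    using peak_pos by (intro mult_left_mono) auto
  with exp_lin_le_decay[OF q, of i] have "exp (c \<bullet> q) \<le> (F + 1) * (exp (- (c $ i * u)) + t)"
    by simp
  with t show ?thesis
    by (simp add: exp_lin_def t_def[symmetric] algebra_simps)
qed

lemma exp_lin_le_peak: "q \<in> shifted_cube v u \<Longrightarrow> exp_lin c q \<le> F"
  using max_value_attained(2)[of c u q v] c u by (simp add: F_def)

lemma concave_envelope_exp_lin:
  defines "env \<equiv> concave_envelope (shifted_cube v u) (exp_lin c)"
  shows "concave_on (shifted_cube v u) env"
    and "\<And>q. q \<in> shifted_cube v u \<Longrightarrow> exp_lin c q \<le> env q"
    and "\<And>h q. concave_on (shifted_cube v u) h \<Longrightarrow> (\<And>y. y \<in> shifted_cube v u \<Longrightarrow> exp_lin c y \<le> h y) \<Longrightarrow>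
           q \<in> shifted_cube v u \<Longrightarrow> env q \<le> h q"
  unfolding env_def
  by (rule concave_envelope_is_least[where ?g0.0 = "\<lambda>_. F"];
      use convex_shifted_cube[OF u] concave_const_shifted_cube[OF u] exp_lin_le_peak in blast)+

lemma envelope_le_affine:
  assumes q: "q \<in> shifted_cube v u"
  shows "concave_envelope (shifted_cube v u) (exp_lin c) q
           \<le> F * ((q $ i - v $ i) / u) + (F + 1) * exp (- (c $ i * u))"
proof (rule concave_envelope_exp_lin(3))
  show "concave_on (shifted_cube v u) (\<lambda>q. F * ((q $ i - v $ i) / u) + (F + 1) * exp (- (c $ i * u)))"
    unfolding concave_on_iff
  proof (intro conjI convex_shifted_cube[OF u] ballI allI impI)
    fix x y a b assume "0 \<le> a" "0 \<le> b" "a + b = (1::real)"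
    then have b: "b = 1 - a" by simp
    show "a * (F * ((x $ i - v $ i) / u) + (F + 1) * exp (- (c $ i * u)))
        + b * (F * ((y $ i - v $ i) / u) + (F + 1) * exp (- (c $ i * u)))
        \<le> F * (((a *\<^sub>R x + b *\<^sub>R y) $ i - v $ i) / u) + (F + 1) * exp (- (c $ i * u))"
      unfolding b using u by (simp add: field_simps)
  qed
qed (use exp_lin_le_affine q in auto)

text \<open>
  Every \<open>q\<close> in the cube is a convex combination of the top corner and a point \<open>r\<close> of the cube, with
  weight \<open>m\<close> on the corner as long as \<open>m * u \<le> q $ i - v $ i\<close> for all \<open>i\<close>. Concavity then gives at
  least \<open>m * F\<close> at \<open>q\<close>, since the envelope is nonnegative at \<open>r\<close>.
\<close>
lemma pyramid_subset_hypograph_envelope: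
  "pyramid v u F \<subseteq> hypograph (shifted_cube v u) (concave_envelope (shifted_cube v u) (exp_lin c))"
proof (rule subrelI)
  fix q s assume "(q, s) \<in> pyramid v u F"
  then have q: "q \<in> shifted_cube v u" and s: "0 \<le> s" "\<And>i. s \<le> F * ((q $ i - v $ i) / u)"
    by (auto simp: pyramid_def)
  let ?E = "concave_envelope (shifted_cube v u) (exp_lin c)"
  have apex: "v + u *\<^sub>R 1 \<in> shifted_cube v u"
    using u by (simp add: mem_shifted_cube[OF u])
  define m where "m = s / F"
  have m: "m * u \<le> q $ i - v $ i" for i
    using s(2)[of i] peak_pos u by (simp add: m_def field_simps)
  have "m * u \<le> 1 * u"
    using m q by (metis mem_shifted_cube[OF u] mult_1 add_le_cancel_left diff_add_cancel add.commute order_trans)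
  then have "m \<le> 1"
    using u by (simp only: mult_le_cancel_right_pos)
  with s(1) peak_pos have m01: "0 \<le> m" "m \<le> 1"
    by (auto simp: m_def)
  have "s \<le> ?E q"
  proof (cases "m = 1")
    case True
    have "q = v + u *\<^sub>R 1"
      unfolding vec_eq_iff
    proof
      fix i
      show "q $ i = (v + u *\<^sub>R 1) $ i"
        using m[of i] q True by (auto simp: mem_shifted_cube[OF u] intro: antisym)
    qed
    then have "F \<le> ?E q"
      using concave_envelope_exp_lin(2)[OF q] by (simp add: F_def)
    then show ?thesis
      using True peak_pos by (simp add: m_def)
  next
    case False
    with m01 have m1: "m < 1" by simp
    define r where "r = (1 / (1 - m)) *\<^sub>R (q - m *\<^sub>R (v + u *\<^sub>R 1))"
    have r_i: "r $ i = (q $ i - m * (v $ i + u)) / (1 - m)" for i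
      by (simp add: r_def)
    have r: "r \<in> shifted_cube v u"
      unfolding mem_shifted_cube[OF u]
    proof
      fix i
      have "q $ i \<le> v $ i + u" using q by (simp add: mem_shifted_cube[OF u])
      with m[of i] m1 show "v $ i \<le> r $ i \<and> r $ i \<le> v $ i + u"
        by (simp add: r_i le_divide_eq divide_le_eq) (simp add: algebra_simps)
    qed
    have q_eq: "q = m *\<^sub>R (v + u *\<^sub>R 1) + (1 - m) *\<^sub>R r"
      using m1 by (simp add: r_def)
    have "0 \<le> ?E r"
      using concave_envelope_exp_lin(2)[OF r] exp_lin_nonneg[OF r, of 1] by simp
    moreover have "F \<le> ?E (v + u *\<^sub>R 1)"
      using concave_envelope_exp_lin(2)[OF apex] by (simp add: F_def)
    ultimately have "m * F + (1 - m) * 0 \<le> m * ?E (v + u *\<^sub>R 1) + (1 - m) * ?E r"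
      using m01 by (intro add_mono mult_left_mono) auto
    also have "\<dots> \<le> ?E q"
      using concave_envelope_exp_lin(1) apex r m01 unfolding q_eq concave_on_iff by auto
    finally show ?thesis
      using peak_pos by (simp add: m_def)
  qed
  with q s(1) show "(q, s) \<in> hypograph (shifted_cube v u) ?E"
    by (simp add: hypograph_def)
qed

lemma hypograph_envelope_subset:
  fixes \<eta> :: real
  assumes \<eta>: "\<And>i. (F + 1) * exp (- (c $ i * u)) \<le> \<eta>"
  shows "hypograph (shifted_cube v u) (concave_envelope (shifted_cube v u) (exp_lin c))
      \<subseteq> cbox (v, 0) (v + u *\<^sub>R 1, \<eta>) \<union> (+) (0, \<eta>) ` pyramid v u F"
proof (rule subrelI, rule UnCI)
  fix q s
  assume *: "(q, s) \<in> hypograph (shifted_cube v u) (concave_envelope (shifted_cube v u) (exp_lin c))"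
    and not: "(q, s) \<notin> (+) (0, \<eta>) ` pyramid v u F"
  have q: "q \<in> shifted_cube v u" and s: "0 \<le> s"
    using * by (auto simp: hypograph_def)
  have "s - \<eta> \<le> F * ((q $ i - v $ i) / u)" for i
    using envelope_le_affine[OF q, of i] \<eta>[of i] * by (simp add: hypograph_def)
  moreover have "(q, s - \<eta>) \<notin> pyramid v u F"
    using not by (auto simp: image_iff)
  ultimately have "s \<le> \<eta>"
    using q by (auto simp: pyramid_def)
  with q s u show "(q, s) \<in> cbox (v, 0) (v + u *\<^sub>R 1, \<eta>)"
    by (simp add: cbox_Pair_eq shifted_cube_eq_cbox)
qed

text \<open>
  The hypograph of the function occupies a vanishing fraction of \<open>Q \<times> {0..F}\<close>: off a thin slab at the
  facet where coordinate \<open>k\<close> is maximal, the function is tiny compared with \<open>F\<close>.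
\<close>
lemma hypograph_exp_lin_subset:
  "hypograph (shifted_cube v u) (exp_lin c)
     \<subseteq> cbox (v, 0) (v + u *\<^sub>R 1, (F + 1) * exp (- (c $ k * (\<delta> * u))))
       \<union> cbox (v + axis k ((1 - \<delta>) * u), 0) (v + u *\<^sub>R 1, F)"
proof (rule subrelI, rule UnCI)
  fix q s
  assume *: "(q, s) \<in> hypograph (shifted_cube v u) (exp_lin c)"
    and not: "(q, s) \<notin> cbox (v + axis k ((1 - \<delta>) * u), 0) (v + u *\<^sub>R 1, F)"
  have q: "q \<in> shifted_cube v u" and s: "0 \<le> s" "s \<le> exp_lin c q"
    using * by (auto simp: hypograph_def)
  have "s \<le> F"
    using s exp_lin_le_peak[OF q] by simp
  have "\<exists>i. q $ i < v $ i + axis k ((1 - \<delta>) * u) $ i"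
  proof (rule ccontr)
    assume "\<nexists>i. q $ i < v $ i + axis k ((1 - \<delta>) * u) $ i"
    then have "q \<in> cbox (v + axis k ((1 - \<delta>) * u)) (v + u *\<^sub>R 1)"
      using q by (auto simp: mem_box_cart mem_shifted_cube[OF u] not_less)
    with not s(1) \<open>s \<le> F\<close> show False
      by (simp add: cbox_Pair_eq)
  qed
  then have "q $ k < v $ k + (1 - \<delta>) * u"
    using q by (auto simp: axis_def mem_shifted_cube[OF u] not_less[symmetric] split: if_splits)
  then have "c $ k * (\<delta> * u) \<le> c $ k * (v $ k + u - q $ k)"
    using c[of k] by (intro mult_left_mono) (auto simp: algebra_simps)
  then have "(F + 1) * exp (- (c $ k * (v $ k + u - q $ k))) \<le> (F + 1) * exp (- (c $ k * (\<delta> * u)))"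
    using peak_pos by (intro mult_left_mono) auto
  with exp_lin_le_decay[OF q, of k] s(2)
  have "s \<le> (F + 1) * exp (- (c $ k * (\<delta> * u)))"
    by (simp add: exp_lin_def)
  with q s(1) u show "(q, s) \<in> cbox (v, 0) (v + u *\<^sub>R 1, (F + 1) * exp (- (c $ k * (\<delta> * u))))"
    by (simp add: cbox_Pair_eq shifted_cube_eq_cbox)
qed

end

section \<open>Asymptotics of the volumes\<close>

text \<open>
  Here \<open>N\<close> is the measure of the cone over the whole prism \<open>Q \<times> {0..F}\<close>, \<open>\<epsilon>\<close> bounds the loss from
  the lower bound \<open>y \<ge> f x\<close>, and \<open>\<eta>\<close> bounds the excess of the envelope over the pyramid, relative to
  \<open>F\<close>.
\<close>
lemma volume_bounds:
  fixes c v :: "real ^ 'n" and u \<delta> :: real and k :: 'n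
  assumes c: "\<And>i. c $ i > 0" and v: "\<And>i. v $ i > 0" and u: "u > 0"
    and \<delta>: "0 \<le> \<delta>" "\<delta> \<le> 1"
  defines "F \<equiv> exp_lin c (v + u *\<^sub>R 1)"
  defines "N \<equiv> u ^ CARD('n) * F / (real CARD('n) + 2)"
    and "\<epsilon> \<equiv> (F + 1) / F * exp (- (c $ k * (\<delta> * u))) + \<delta>"
    and "\<eta> \<equiv> (F + 1) / F * (\<Sum>i\<in>UNIV. exp (- (c $ i * u)))"
  shows "measure lebesgue (naive_relaxation (exp_lin c) (shifted_cube v u) (\<lambda>_. max_value c v u)) / N
           \<in> {1 - \<epsilon>..1}"
    and "measure lebesgue (naive_relaxation (exp_lin c) (shifted_cube v u)
           (concave_envelope (shifted_cube v u) (exp_lin c))) / N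
           \<in> {1 / (real CARD('n) + 1) - \<epsilon>..1 / (real CARD('n) + 1) + \<eta>}"
proof -
  let ?Q = "shifted_cube v u" and ?f = "exp_lin c" and ?d = "CARD('n)"
  let ?env = "concave_envelope ?Q ?f"
  have F: "F > 0"
    unfolding F_def by (rule peak_pos[OF c v u])
  have max: "max_value c v u = F"
    unfolding F_def by (rule max_value_attained(3)[OF c u])
  have Q: "?Q \<noteq> {}"
    using max_value_attained(1)[OF c u] by blast
  define V where "V = u ^ ?d * F"
  have V: "V > 0" using u F by (simp add: V_def)
  have NV: "N = V / (real ?d + 2)" by (simp add: N_def V_def)
  have normalise: "x / N = (real ?d + 2) * x / V" for x
    by (simp add: NV)
  let ?E3 = "cbox (v, 0) (v + u *\<^sub>R 1, (F + 1) * exp (- (c $ k * (\<delta> * u))))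
       \<union> cbox (v + axis k ((1 - \<delta>) * u), 0) (v + u *\<^sub>R 1, F)"
  have E3: "?E3 \<in> sets borel" "bounded ?E3" "hypograph ?Q ?f \<subseteq> ?E3"
    using hypograph_exp_lin_subset[OF c v u, of k \<delta>] unfolding F_def by (auto simp: bounded_Un)
  have "measure lborel ?E3 \<le> measure lborel (cbox (v, 0) (v + u *\<^sub>R 1, (F + 1) * exp (- (c $ k * (\<delta> * u)))))
     + measure lborel (cbox (v + axis k ((1 - \<delta>) * u), 0) (v + u *\<^sub>R 1, F))"
    by (rule measure_Un_le) auto
  also have "\<dots> = u ^ ?d * ((F + 1) * exp (- (c $ k * (\<delta> * u)))) + \<delta> * u ^ ?d * F"
    using content_slab[OF u _ \<delta>, of F v k] F u
    by (simp add: content_cube_interval)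
  also have "\<dots> = \<epsilon> * V"
    using F by (simp add: \<epsilon>_def V_def field_simps)
  finally have vol3: "measure lborel ?E3 \<le> \<epsilon> * V" .

  have nonneg: "0 \<le> ?f (z *\<^sub>R q)" if "q \<in> ?Q" "0 \<le> z" "z \<le> 1" for q z
    using exp_lin_nonneg[OF c v u that(1,2)] .

  have f0: "?f 0 = 0" by (simp add: exp_lin_def)

  let ?B = "cbox (v, 0) (v + u *\<^sub>R 1, F)"
  let ?P = "measure lebesgue (naive_relaxation ?f ?Q (\<lambda>_. F))"
  have B: "hypograph ?Q (\<lambda>_. F) = ?B"
    using u by (auto simp: hypograph_def cbox_Pair_eq shifted_cube_eq_cbox)
  have "convex (hypograph ?Q (\<lambda>_. F))"
    by (intro convex_hypograph concave_const_shifted_cube[OF u])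
  moreover have "?B \<in> sets borel" "bounded ?B" "?B \<subseteq> hypograph ?Q (\<lambda>_. F)" "hypograph ?Q (\<lambda>_. F) \<subseteq> ?B"
    by (auto simp: B simp del: cbox_Pair_iff)
  ultimately have "measure lborel ?B - measure lborel ?E3 \<le> (real DIM(real ^ 'n) + 2) * ?P"
    "(real DIM(real ^ 'n) + 2) * ?P \<le> measure lborel ?B"
    using measure_naive_relaxation_bounds[OF Q convex_exp_lin f0 nonneg _ _ _ _ _ _ E3] by blast+
  then have "V - \<epsilon> * V \<le> (real ?d + 2) * ?P" "(real ?d + 2) * ?P \<le> V"
    using vol3 u F by (simp_all add: content_cube_interval V_def)
  then show "measure lebesgue (naive_relaxation ?f ?Q (\<lambda>_. max_value c v u)) / N \<in> {1 - \<epsilon>..1}"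
    unfolding max normalise using V by (simp add: le_divide_eq divide_le_eq algebra_simps)

  let ?R = "measure lebesgue (naive_relaxation ?f ?Q ?env)"
  let ?E2 = "cbox (v, 0) (v + u *\<^sub>R 1, F * \<eta>) \<union> (+) (0, F * \<eta>) ` pyramid v u F"
  have F\<eta>: "F * \<eta> = (F + 1) * (\<Sum>i\<in>UNIV. exp (- (c $ i * u)))"
    using F by (simp add: \<eta>_def)
  have \<eta>: "\<eta> \<ge> 0"
    unfolding \<eta>_def using F by (intro mult_nonneg_nonneg sum_nonneg) auto
  have \<eta>_ge: "(F + 1) * exp (- (c $ i * u)) \<le> F * \<eta>" for i
    unfolding F\<eta> using F by (intro mult_left_mono member_le_sum) auto
  have E1: "pyramid v u F \<in> sets borel" "pyramid v u F \<subseteq> hypograph ?Q ?env"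
    using closed_pyramid[OF u, of v F] pyramid_subset_hypograph_envelope[OF c v u]
    unfolding F_def by (auto simp: borel_closed)
  have trans: "(+) (0, F * \<eta>) ` pyramid v u F \<in> sets borel"
    using closed_pyramid[OF u, of v F] by (intro borel_closed closed_translation)
  have E2: "?E2 \<in> sets borel" "bounded ?E2" "hypograph ?Q ?env \<subseteq> ?E2"
  proof -
    show "?E2 \<in> sets borel" using trans by auto
    have "bounded (pyramid v u F)"
      using pyramid_subset[OF u F] bounded_cbox bounded_subset by blast
    then show "bounded ?E2"
      by (auto simp: bounded_Un intro: bounded_translation)
    show "hypograph ?Q ?env \<subseteq> ?E2"
      using hypograph_envelope_subset[OF c v u] \<eta>_ge unfolding F_def by blast
  qed
  have "measure lborel ?E2 \<le> measure lborel (cbox (v, 0) (v + u *\<^sub>R 1, F * \<eta>))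
      + measure lborel ((+) (0, F * \<eta>) ` pyramid v u F)"
    using trans by (intro measure_Un_le) auto
  also have "measure lborel ((+) (0, F * \<eta>) ` pyramid v u F) = measure lborel (pyramid v u F)"
    using measure_translation[of "(0, F * \<eta>)" "pyramid v u F"] trans E1(1) by simp
  also have "measure lborel (cbox (v, 0) (v + u *\<^sub>R 1, F * \<eta>)) = V * \<eta>"
    using u F \<eta> by (simp add: content_cube_interval V_def)
  also have "measure lborel (pyramid v u F) = V / (real ?d + 1)"
    using content_pyramid[OF u F] by (simp add: V_def)
  finally have vol2: "measure lborel ?E2 \<le> V * \<eta> + V / (real ?d + 1)" .
  have "concave_on ?Q ?env"
    using concave_envelope_exp_lin(1)[OF c v u] .
  then have conv: "convex (hypograph ?Q ?env)"
    by (rule convex_hypograph)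
  have "measure lborel (pyramid v u F) - measure lborel ?E3 \<le> (real DIM(real ^ 'n) + 2) * ?R"
    "(real DIM(real ^ 'n) + 2) * ?R \<le> measure lborel ?E2"
    using measure_naive_relaxation_bounds[OF Q convex_exp_lin f0 nonneg conv E1 E2 E3] by blast+
  then have "V / (real ?d + 1) - \<epsilon> * V \<le> (real ?d + 2) * ?R"
      "(real ?d + 2) * ?R \<le> V * \<eta> + V / (real ?d + 1)"
    using vol2 vol3 content_pyramid[OF u F, of v] by (simp_all add: V_def)
  then have "(V / (real ?d + 1) - \<epsilon> * V) / V \<le> (real ?d + 2) * ?R / V"
      "(real ?d + 2) * ?R / V \<le> (V * \<eta> + V / (real ?d + 1)) / V"
    using V by (intro divide_right_mono; simp)+
  then show "?R / N \<in> {1 / (real ?d + 1) - \<epsilon>..1 / (real ?d + 1) + \<eta>}"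
    unfolding normalise using V by (simp add: add_divide_distrib diff_divide_distrib)
qed

lemma tendsto_exp_neg_mult:
  fixes a :: real
  assumes "a > 0" "filterlim g at_top at_top"
  shows "((\<lambda>u. exp (- (a * g u))) \<longlongrightarrow> 0) at_top"
proof (rule filterlim_compose[OF exp_at_bot])
  show "filterlim (\<lambda>u. - (a * g u)) at_bot at_top"
    using filterlim_tendsto_pos_mult_at_top[OF tendsto_const assms]
    by (simp add: filterlim_uminus_at_bot)
qed

theorem lemma4p3:
  fixes c v0 :: "real ^ 'n"
  assumes "\<And>i. c $ i > 0" and "\<And>i. v0 $ i > 0"
  shows "((\<lambda>u. measure lebesgue
                 (naive_relaxation (exp_lin c) (shifted_cube v0 u) (\<lambda>_. max_value c v0 u))
             / measure lebesgue
                 (naive_relaxation (exp_lin c) (shifted_cube v0 u)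
                    (concave_envelope (shifted_cube v0 u) (exp_lin c))))
          \<longlongrightarrow> real CARD('n) + 1) at_top"
proof -
  \<comment> \<open>Any coordinate will do.\<close>
  define k :: 'n where "k = undefined"
  define F where "F u = exp_lin c (v0 + u *\<^sub>R 1)" for u
  define N where "N u = u ^ CARD('n) * F u / (real CARD('n) + 2)" for u
  define A where "A u = measure lebesgue
    (naive_relaxation (exp_lin c) (shifted_cube v0 u) (\<lambda>_. max_value c v0 u))" for u
  define B where "B u = measure lebesgue (naive_relaxation (exp_lin c) (shifted_cube v0 u)
    (concave_envelope (shifted_cube v0 u) (exp_lin c)))" for u
  \<comment> \<open>The relative slab width \<open>\<delta> = 1 / sqrt u\<close> tends to \<open>0\<close> while \<open>\<delta> * u = sqrt u\<close> tends to infinity.\<close>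
  define \<epsilon> where "\<epsilon> u = (F u + 1) / F u * exp (- (c $ k * sqrt u)) + inverse (sqrt u)" for u
  define \<eta> where "\<eta> u = (F u + 1) / F u * (\<Sum>i\<in>UNIV. exp (- (c $ i * u)))" for u
  have N: "N u > 0" if "u \<ge> 1" for u
    using peak_pos[OF assms, of u] that by (simp add: N_def F_def add_pos_pos)
  have bounds: "1 - \<epsilon> u \<le> A u / N u" "A u / N u \<le> 1"
     "1 / (real CARD('n) + 1) - \<epsilon> u \<le> B u / N u" "B u / N u \<le> 1 / (real CARD('n) + 1) + \<eta> u"
    if "u \<ge> 1" for u
  proof -
    have "0 \<le> inverse (sqrt u)" "inverse (sqrt u) \<le> 1" "u > 0"
      using that by (auto intro!: inverse_le_1_iff[THEN iffD2])
    moreover have "inverse (sqrt u) * u = sqrt u"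
      using that by (simp add: field_simps)
    ultimately show "1 - \<epsilon> u \<le> A u / N u" "A u / N u \<le> 1"
     "1 / (real CARD('n) + 1) - \<epsilon> u \<le> B u / N u" "B u / N u \<le> 1 / (real CARD('n) + 1) + \<eta> u"
      using volume_bounds[OF assms, of u "inverse (sqrt u)" k]
      unfolding N_def F_def \<epsilon>_def \<eta>_def A_def B_def by simp_all
  qed
  have large: "eventually (\<lambda>u::real. u \<ge> 1) at_top"
    by (rule eventually_ge_at_top)
  have c1: "c \<bullet> 1 > 0"
    unfolding inner_vec_def using assms(1) by (intro sum_pos) auto
  have "F = (\<lambda>u. - 1 + exp (c \<bullet> v0 + c \<bullet> 1 * u))"
    by (simp add: F_def exp_lin_def inner_add_right fun_eq_iff mult.commute)
  moreover have "filterlim (\<lambda>u. - 1 + exp (c \<bullet> v0 + c \<bullet> 1 * u)) at_top at_top"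
    by (intro filterlim_tendsto_add_at_top[OF tendsto_const] filterlim_compose[OF exp_at_top]
        filterlim_tendsto_pos_mult_at_top[OF tendsto_const c1] filterlim_ident)
  ultimately have F_top: "filterlim F at_top at_top"
    by simp
  have "((\<lambda>u. 1 + inverse (F u)) \<longlongrightarrow> 1 + 0) at_top"
    by (intro tendsto_intros filterlim_compose[OF tendsto_inverse_0_at_top F_top] filterlim_ident
        tendsto_inverse_0_at_top F_top)
  moreover have "eventually (\<lambda>u. 1 + inverse (F u) = (F u + 1) / F u) at_top"
    using filterlim_at_top_dense[THEN iffD1, OF F_top, rule_format, of 0]
    by eventually_elim (simp add: field_simps)
  ultimately have ratio: "((\<lambda>u. (F u + 1) / F u) \<longlongrightarrow> 1) at_top"
    by (simp add: filterlim_cong)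
  have "(\<epsilon> \<longlongrightarrow> 1 * 0 + 0) at_top"
    unfolding \<epsilon>_def
    by (intro tendsto_add tendsto_mult ratio tendsto_exp_neg_mult assms(1) sqrt_at_top
        tendsto_inverse_0_at_top)
  then have \<epsilon>: "(\<epsilon> \<longlongrightarrow> 0) at_top" by simp
  have "(\<eta> \<longlongrightarrow> 1 * (\<Sum>i\<in>(UNIV :: 'n set). 0)) at_top"
    unfolding \<eta>_def
    by (intro tendsto_mult ratio tendsto_sum tendsto_exp_neg_mult assms(1) filterlim_ident)
  then have \<eta>: "(\<eta> \<longlongrightarrow> 0) at_top" by simp
  have "((\<lambda>u. A u / N u) \<longlongrightarrow> 1) at_top"
  proof (rule tendsto_sandwich)
    show "((\<lambda>u. 1 - \<epsilon> u) \<longlongrightarrow> 1) at_top"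
      using tendsto_diff[OF tendsto_const \<epsilon>, of 1] by simp
    show "((\<lambda>_. 1) \<longlongrightarrow> 1) at_top" by simp
  qed (use bounds in \<open>auto intro!: eventually_mono[OF large]\<close>)
  moreover have "((\<lambda>u. B u / N u) \<longlongrightarrow> 1 / (real CARD('n) + 1)) at_top"
  proof (rule tendsto_sandwich)
    show "((\<lambda>u. 1 / (real CARD('n) + 1) - \<epsilon> u) \<longlongrightarrow> 1 / (real CARD('n) + 1)) at_top"
      using tendsto_diff[OF tendsto_const \<epsilon>, of "1 / (real CARD('n) + 1)"] by simp
    show "((\<lambda>u. 1 / (real CARD('n) + 1) + \<eta> u) \<longlongrightarrow> 1 / (real CARD('n) + 1)) at_top"
      using tendsto_add[OF tendsto_const \<eta>, of "1 / (real CARD('n) + 1)"] by simp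
  qed (use bounds in \<open>auto intro!: eventually_mono[OF large]\<close>)
  ultimately have "((\<lambda>u. (A u / N u) / (B u / N u)) \<longlongrightarrow> 1 / (1 / (real CARD('n) + 1))) at_top"
    by (rule tendsto_divide) simp
  moreover have "eventually (\<lambda>u. (A u / N u) / (B u / N u) = A u / B u) at_top"
    using large by eventually_elim (use N in force)
  ultimately have "((\<lambda>u. A u / B u) \<longlongrightarrow> real CARD('n) + 1) at_top"
    using Lim_transform_eventually by fastforce
  then show ?thesis
    by (simp add: A_def B_def)
qed

end
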